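(* Let $p$ be an odd prime, $n$ a positive integer, $q=p^n$ with $q\equiv1\pmod4$, let $\xi\in\mathbb F_{q^2}\setminus\mathbb F_q$, write $x=x_0+x_1\xi$ ($x_0,x_1\in\mathbb F_q$), and let $\alpha$ be a nonsquare in $\mathbb F_q$. Let $f$ be either $f(x)=(x_0^2+\alpha x_1^{2p^i})+2x_0x_1\xi$ with $0<i<n$, or $f(x)=(x_0^{p^k+1}+\alpha x_1^{p^{k+i}+p^i})+2x_0x_1\xi$ with $0<i,k<n$ and $n/\gcd(k,n)$ odd, and let $\mathcal U_\xi:=\{(x,t\xi):x\in\mathbb F_{q^2},t\in\mathbb F_q\}\cup\{(\infty)\}$, which is a unital in $\Pi(f)$. If there is $\omega\in\mathbb F_q$ with $\omega^2-\omega+1=0$, then $\mathcal U_\xi$ contains an O'Nan configuration.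
   Context: For a planar function $f$ on $\mathbb F_{q^2}$ (i.e.\ $x\mapsto f(x+a)-f(x)$ is bijective for each $a\neq0$; both functions above are planar), $\Pi(f)$ is the projective plane with points $(x,y)\in\mathbb F_{q^2}^2$ and $(a)$ for $a\in\mathbb F_{q^2}\cup\{\infty\}$, lines $L_{a,b}=\{(x,f(x+a)-b):x\in\mathbb F_{q^2}\}\cup\{(a)\}$, $N_a=\{(a,y):y\in\mathbb F_{q^2}\}\cup\{(\infty)\}$ ($a,b\in\mathbb F_{q^2}$), $L_\infty=\{(a):a\in\mathbb F_{q^2}\cup\{\infty\}\}$. A unital is a set of $q^3+1$ points meeting every line in $1$ or $q+1$ points, regarded as a design whose blocks are its intersections with lines meeting it in $q+1$ points. An O'Nan configuration consists of four blocks, any two of which meet, such that the six pairwise intersection points are distinct. *)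

theory Defs
  imports Main "HOL-Computational_Algebra.Primes"
begin

text \<open>Elements of F_{q^2} are represented by their coordinates (x0, x1) in F_q with
  respect to the F_q-basis 1, xi of F_{q^2}:  x = x0 + x1 xi.  Only the additive
  structure of F_{q^2} (coordinatewise) enters the plane Pi(f).\<close>

type_synonym 'a ext = "'a \<times> 'a"

definition eadd :: "'a::field ext \<Rightarrow> 'a ext \<Rightarrow> 'a ext" where
  "eadd x y = (fst x + fst y, snd x + snd y)"

definition esub :: "'a::field ext \<Rightarrow> 'a ext \<Rightarrow> 'a ext" where
  "esub x y = (fst x - fst y, snd x - snd y)"

datatype 'e ppoint = Aff 'e 'e | Dir 'e | DirInf

datatype 'e pline = Lab 'e 'e | Na 'e | LInf

fun incid :: "('a::field ext \<Rightarrow> 'a ext) \<Rightarrow> 'a ext ppoint \<Rightarrow> 'a ext pline \<Rightarrow> bool" where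
  "incid f (Aff x y) (Lab a b) = (y = esub (f (eadd x a)) b)"
| "incid f (Dir c) (Lab a b) = (c = a)"
| "incid f DirInf (Lab a b) = False"
| "incid f (Aff x y) (Na a) = (x = a)"
| "incid f (Dir c) (Na a) = False"
| "incid f DirInf (Na a) = True"
| "incid f (Aff x y) LInf = False"
| "incid f (Dir c) LInf = True"
| "incid f DirInf LInf = True"

definition points_of :: "('a::field ext \<Rightarrow> 'a ext) \<Rightarrow> 'a ext pline \<Rightarrow> 'a ext ppoint set" where
  "points_of f l = {P. incid f P l}"

text \<open>The unital U_xi = {(x, t xi)} \<union> {(infinity)}; t xi has coordinates (0,t).\<close>
definition U_xi :: "'a::field ext ppoint set" where
  "U_xi = {Aff x (0, t) | x t. True} \<union> {DirInf}"

definition blocks :: "('a::field ext \<Rightarrow> 'a ext) \<Rightarrow> nat \<Rightarrow> 'a ext ppoint set \<Rightarrow> 'a ext ppoint set set" where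
  "blocks f q U = {points_of f l \<inter> U | l. card (points_of f l \<inter> U) = q + 1}"

definition has_ONan :: "('a::field ext \<Rightarrow> 'a ext) \<Rightarrow> nat \<Rightarrow> 'a ext ppoint set \<Rightarrow> bool" where
  "has_ONan f q U = (\<exists>B :: nat \<Rightarrow> 'a ext ppoint set. \<exists>P :: nat \<Rightarrow> nat \<Rightarrow> 'a ext ppoint.
     (\<forall>i<4. B i \<in> blocks f q U) \<and>
     (\<forall>i<4. \<forall>j<4. i \<noteq> j \<longrightarrow> B i \<noteq> B j) \<and>
     (\<forall>i<4. \<forall>j<4. i < j \<longrightarrow> B i \<inter> B j = {P i j}) \<and>
     (\<forall>i<4. \<forall>j<4. \<forall>k<4. \<forall>l<4. i < j \<and> k < l \<and> (i, j) \<noteq> (k, l) \<longrightarrow> P i j \<noteq> P k l))"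

definition f_one :: "'a::field \<Rightarrow> nat \<Rightarrow> nat \<Rightarrow> 'a ext \<Rightarrow> 'a ext" where
  "f_one \<alpha> p i x = (fst x ^ 2 + \<alpha> * snd x ^ (2 * p ^ i), 2 * fst x * snd x)"

definition f_two :: "'a::field \<Rightarrow> nat \<Rightarrow> nat \<Rightarrow> nat \<Rightarrow> 'a ext \<Rightarrow> 'a ext" where
  "f_two \<alpha> p k i x = (fst x ^ (p ^ k + 1) + \<alpha> * snd x ^ (p ^ (k + i) + p ^ i), 2 * fst x * snd x)"

end

theory Submission
  imports Defs "HOL-Computational_Algebra.Polynomial" "HOL-Library.Cardinality"
begin

text \<open>Both functions are \<open>(x0, x1) \<mapsto> (x0^(r+1) + \<alpha> x1^(s(r+1)), 2 x0 x1)\<close> for powers \<open>r\<close>, \<open>s\<close> of \<open>p\<close>, where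
  \<open>x \<mapsto> x^r\<close> is a field automorphism of odd order (the identity for the first function). So
  \<open>v \<mapsto> v^r + v\<close> is bijective, and the line \<open>L_{a,b}\<close> meets the unital in the points whose translates by \<open>a\<close>
  lie on the curve \<open>x0^(r+1) + \<alpha> x1^(s(r+1)) = b0\<close>. Since \<open>x \<mapsto> x^((r+1)/2)\<close> is a bijection, this curve has
  as many points as an anisotropic conic, namely \<open>q + 1\<close>, when \<open>b0 \<noteq> 0\<close>.

  An O'Nan configuration is formed by \<open>N_0\<close> and three lines \<open>L_{c,b}\<close> whose curves pass through the origin, the
  shifts \<open>c\<close> being the vertices of a right-angled triangle with legs parallel to the axes. Their second
  coordinates lie in the prime field, where the Frobenius powers are trivial, and their first coordinates are
  \<open>-h\<close>, \<open>-h\<close>, \<open>h - 1\<close> with \<open>h^r + h = \<alpha> + 1\<close>.\<close>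

section \<open>Finite fields\<close>

text \<open>Multiplication by \<open>x\<close> permutes the nonzero elements, so their product is
  unchanged by a factor \<open>x ^ (CARD('a) - 1)\<close> and can be cancelled.\<close>

lemma finite_field_power_card_minus_1:
  fixes x :: "'a::{field, finite}"
  assumes "x \<noteq> 0"
  shows "x ^ (CARD('a) - 1) = 1"
proof -
  have "bij_betw ((*) x) (UNIV - {0}) (UNIV - {0})"
    by (rule bij_betw_byWitness[where f' = "\<lambda>y. y / x"]) (use assms in auto)
  then have "(\<Prod>y\<in>UNIV - {0}. x * y) = (\<Prod>y\<in>UNIV - {0}. y)"
    by (rule prod.reindex_bij_betw)
  then show ?thesis
    by (simp add: prod.distrib)
qed

lemma finite_field_power_card:
  fixes x :: "'a::{field, finite}"
  shows "x ^ CARD('a) = x"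
  using finite_field_power_card_minus_1[of x] power_minus_mult[of "CARD('a)" x]
  by (cases "x = 0") auto

lemma finite_field_power_card_power:
  fixes x :: "'a::{field, finite}"
  shows "x ^ (CARD('a) ^ j) = x"
  by (induction j) (simp_all add: power_mult finite_field_power_card)

text \<open>Translation by 1 permutes the field, so summing all elements gives
  \<open>of_nat (CARD('a)) = 0\<close>; the characteristic is then a prime divisor of
  \<open>p ^ n\<close>.\<close>

lemma finite_field_CHAR:
  assumes "prime p" "CARD('a::{field, finite}) = p ^ n"
  shows "CHAR('a) = p"
proof -
  have "bij ((+) (1::'a))"
    by (rule bij_betw_byWitness[where f' = "\<lambda>y. y - 1"]) auto
  then have "(\<Sum>y\<in>UNIV. 1 + y) = (\<Sum>y\<in>UNIV. y :: 'a)"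
    by (rule sum.reindex_bij_betw)
  then have "of_nat (CARD('a)) = (0::'a)"
    by (simp add: sum.distrib)
  then have "CHAR('a) dvd p ^ n"
    using assms(2) by (simp only: of_nat_eq_0_iff_char_dvd)
  moreover have "prime CHAR('a)"
    using finite_imp_CHAR_pos[where 'a = 'a] by (intro prime_CHAR_semidom) auto
  ultimately show ?thesis
    using assms(1) prime_dvd_power primes_dvd_imp_eq by blast
qed

text \<open>For a field of \<open>4 * j + 1\<close> elements, \<open>?P\<close> has too few roots to
  cover the nonzero ones, so some \<open>y ^ (2 * j)\<close> is not 1. Its square is 1, so it is -1,
  and \<open>y ^ j\<close> is the required root.\<close>

lemma finite_field_sqrt_minus_1:
  assumes "CARD('a::{field, finite}) mod 4 = 1"
  shows "\<exists>\<iota>::'a. \<iota> ^ 2 = -1"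
proof -
  obtain j where j: "CARD('a) = 4 * j + 1"
    using assms by (metis mult_div_mod_eq)
  have "j > 0"
    using j finite_field_power_card_minus_1[of "1::'a"] card_mono[of UNIV "{0, 1::'a}"] by (cases j) auto
  let ?P = "monom 1 (2 * j) - 1 :: 'a poly"
  have deg: "degree ?P \<le> 2 * j"
    by (rule degree_diff_le) (auto simp: degree_monom_le)
  have "coeff ?P (2 * j) = 1"
    using \<open>j > 0\<close> by simp
  then have "?P \<noteq> 0"
    by (metis coeff_0 zero_neq_one)
  then have "card {x. poly ?P x = 0} \<le> 2 * j"
    using card_poly_roots_bound deg order_trans by blast
  moreover have "card (UNIV - {0::'a}) = 4 * j"
    by (simp add: j)
  ultimately have "\<not> UNIV - {0} \<subseteq> {x. poly ?P x = 0}"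
    using card_mono[of "{x. poly ?P x = 0}" "UNIV - {0}"] \<open>j > 0\<close> by auto
  then obtain y :: 'a where "y \<noteq> 0" "y ^ (2 * j) \<noteq> 1"
    by (auto simp: poly_monom)
  moreover have "(y ^ (2 * j)) ^ 2 = 1"
    using finite_field_power_card_minus_1[OF \<open>y \<noteq> 0\<close>] by (simp add: j mult.commute flip: power_mult)
  ultimately have "y ^ (2 * j) = -1"
    by (simp add: power2_eq_1_iff)
  then have "(y ^ j) ^ 2 = -1"
    by (simp add: mult.commute flip: power_mult)
  then show ?thesis by blast
qed

section \<open>Squares and points on anisotropic conics\<close>

lemma card_squares_ge:
  "CARD('a::{field, finite}) + 1 \<le> 2 * card (range (\<lambda>x::'a. x ^ 2))"
proof -
  let ?S = "range (\<lambda>x::'a. x ^ 2)"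
  have "(\<Sum>y\<in>?S. \<Sum>x\<in>{x \<in> UNIV. x ^ 2 = y}. (1::nat)) = (\<Sum>x\<in>(UNIV :: 'a set). 1)"
    by (rule sum.group) auto
  then have "CARD('a) = (\<Sum>y\<in>?S. card {x. x ^ 2 = y})"
    by simp
  also have "\<dots> = card {x::'a. x ^ 2 = 0} + (\<Sum>y\<in>?S - {0}. card {x. x ^ 2 = y})"
    by (rule sum.remove) (auto intro: rev_image_eqI[of 0])
  \<comment> \<open>Only 0 squares to 0, and a nonzero square has at most the two roots
    \<open>z\<close> and \<open>- z\<close>.\<close>
  also have "\<dots> \<le> 1 + (\<Sum>y\<in>?S - {0}. 2)"
  proof (intro add_mono sum_mono)
    fix y :: 'a assume "y \<in> ?S - {0}"
    then obtain z where "y = z ^ 2" by auto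
    then have "{x. x ^ 2 = y} \<subseteq> {z, - z}"
      by (auto simp: power2_eq_iff)
    then have "card {x. x ^ 2 = y} \<le> card {z, - z}"
      by (intro card_mono) auto
    also have "\<dots> \<le> 2" by (simp add: card_insert_if)
    finally show "card {x. x ^ 2 = y} \<le> 2" .
  qed simp
  also have "\<dots> = 1 + 2 * (card ?S - 1)"
    by (simp add: image_iff card_Diff_singleton_if)
  finally show ?thesis
    using card_gt_0_iff[of ?S] by auto
qed

text \<open>The form is the norm of the quadratic extension by a root of \<open>- \<alpha>\<close>.
  Multiplication by elements of suitable norm shows that all nonzero fibres have equal size; the
  zero fibre is a single point, so counting all pairs gives the size.\<close>

lemma card_anisotropic_conic:
  fixes \<alpha> b :: "'a::{field, finite}"
  assumes aniso: "\<And>y. y ^ 2 \<noteq> - \<alpha>" and "b \<noteq> 0"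
  shows "card {(u, v). u ^ 2 + \<alpha> * v ^ 2 = b} = CARD('a) + 1"
proof -
  define F where "F b = {w :: 'a \<times> 'a. fst w ^ 2 + \<alpha> * snd w ^ 2 = b}" for b
  have "\<alpha> \<noteq> 0"
    using aniso[of 0] by auto
  have F0: "F 0 = {(0, 0)}"
  proof -
    have zero: "u = 0 \<and> v = 0" if "u ^ 2 + \<alpha> * v ^ 2 = 0" for u v
    proof (cases "v = 0")
      case False
      have "u ^ 2 = - \<alpha> * v ^ 2"
        using that by (simp add: eq_neg_iff_add_eq_0)
      with False have "(u / v) ^ 2 = - \<alpha>"
        by (simp add: power_divide)
      then show ?thesis using aniso by blast
    qed (use that in simp)
    have "w = (0, 0)" if "w \<in> F 0" for w
      using zero[of "fst w" "snd w"] that unfolding F_def by (simp add: prod_eq_iff)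
    moreover have "(0, 0) \<in> F 0"
      by (simp add: F_def)
    ultimately show ?thesis by blast
  qed
  have nonempty: "F c \<noteq> {}" for c
  proof -
    \<comment> \<open>Pigeonhole: the squares and their images under \<open>c - \<alpha> * y\<close>
      each fill more than half of the field, so they meet.\<close>
    let ?S = "range (\<lambda>x::'a. x ^ 2)"
    have "inj (\<lambda>y. c - \<alpha> * y)"
      using \<open>\<alpha> \<noteq> 0\<close> by (auto intro: injI)
    then have "card ((\<lambda>y. c - \<alpha> * y) ` ?S) = card ?S"
      by (intro card_image) (rule inj_on_subset, auto)
    moreover have "card (?S \<union> (\<lambda>y. c - \<alpha> * y) ` ?S) \<le> CARD('a)"
      by (intro card_mono) auto
    ultimately have "card (?S \<union> (\<lambda>y. c - \<alpha> * y) ` ?S) \<noteq> card ?S + card ((\<lambda>y. c - \<alpha> * y) ` ?S)"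
      using card_squares_ge[where 'a = 'a] by linarith
    then have "?S \<inter> (\<lambda>y. c - \<alpha> * y) ` ?S \<noteq> {}"
      by (metis card_Un_disjoint finite)
    then obtain u v where "u ^ 2 = c - \<alpha> * v ^ 2" by auto
    then have "(u, v) \<in> F c" by (simp add: F_def)
    then show ?thesis by blast
  qed
  have mult: "card (F a) \<le> card (F (a * c))" if "c \<noteq> 0" for a c
  proof -
    obtain w0 w1 where w: "w0 ^ 2 + \<alpha> * w1 ^ 2 = c"
      using nonempty[of c] by (auto simp: F_def)
    \<comment> \<open>multiplication by \<open>w0 + w1 \<surd>(-\<alpha>)\<close> in the quadratic extension\<close>
    let ?M = "\<lambda>(u, v). (u * w0 - \<alpha> * v * w1, u * w1 + v * w0)"
    let ?M' = "\<lambda>(u, v). ((u * w0 + \<alpha> * v * w1) / c, (v * w0 - u * w1) / c)"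
    have "?M' (?M (u, v)) = (u, v)" for u v
    proof -
      have "(u * w0 - \<alpha> * v * w1) * w0 + \<alpha> * (u * w1 + v * w0) * w1 = u * c"
           "(u * w1 + v * w0) * w0 - (u * w0 - \<alpha> * v * w1) * w1 = v * c"
        unfolding w[symmetric] by algebra+
      then show ?thesis using that by simp
    qed
    then have "inj ?M"
      by (intro inj_on_inverseI[where g = ?M']) auto
    moreover have "?M ` F a \<subseteq> F (a * c)"
    proof -
      have "(u * w0 - \<alpha> * v * w1) ^ 2 + \<alpha> * (u * w1 + v * w0) ^ 2 = (u ^ 2 + \<alpha> * v ^ 2) * c" for u v
        unfolding w[symmetric] by algebra
      then show ?thesis by (auto simp: F_def)
    qed
    ultimately show ?thesis
      by (intro card_inj_on_le[of ?M]) (auto intro: inj_on_subset)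
  qed
  have same: "card (F c) = card (F b)" if "c \<noteq> 0" for c
    using mult[of "b / c" c] mult[of "c / b" b] that \<open>b \<noteq> 0\<close> by auto
  have "(\<Sum>c\<in>UNIV. \<Sum>w\<in>{w \<in> UNIV. fst w ^ 2 + \<alpha> * snd w ^ 2 = c}. (1::nat)) = (\<Sum>w\<in>(UNIV :: ('a \<times> 'a) set). 1)"
    by (rule sum.group) auto
  then have "CARD('a) * CARD('a) = (\<Sum>c\<in>UNIV. card (F c))"
    by (simp add: F_def)
  also have "\<dots> = card (F 0) + (\<Sum>c\<in>UNIV - {0}. card (F c))"
    by (rule sum.remove) auto
  also have "\<dots> = 1 + (CARD('a) - 1) * card (F b)"
    by (simp add: F0 same)
  finally have eq: "CARD('a) * CARD('a) = 1 + (CARD('a) - 1) * card (F b)" .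
  have "CARD('a) \<ge> 2"
    using card_mono[of UNIV "{0, 1::'a}"] by simp
  \<comment> \<open>Writing the field size as \<open>t + 2\<close> avoids truncated subtraction and
    turns the count into \<open>(t + 2)^2 - 1 = (t + 1) * (t + 3)\<close>.\<close>
  then obtain t where t: "CARD('a) = t + 2"
    by (metis add.commute le_Suc_ex)
  have "(t + 1) * card (F b) = (t + 1) * (t + 3)"
    using eq by (simp add: t algebra_simps)
  then have "card (F b) = CARD('a) + 1"
    by (simp add: t del: mult_Suc)
  moreover have "{(u, v). u ^ 2 + \<alpha> * v ^ 2 = b} = F b"
    by (auto simp: F_def)
  ultimately show ?thesis by simp
qed

section \<open>O'Nan configurations in the unital\<close>

lemma has_ONanI:
  assumes blocks: "B0 \<in> blocks f q U" "B1 \<in> blocks f q U" "B2 \<in> blocks f q U" "B3 \<in> blocks f q U"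
    and meets: "B0 \<inter> B1 = {P01}" "B0 \<inter> B2 = {P02}" "B0 \<inter> B3 = {P03}"
      "B1 \<inter> B2 = {P12}" "B1 \<inter> B3 = {P13}" "B2 \<inter> B3 = {P23}"
    and dist: "distinct [P01, P02, P03, P12, P13, P23]"
  shows "has_ONan f q U"
proof -
  have all4: "(\<forall>i<4. R i) \<longleftrightarrow> R 0 \<and> R 1 \<and> R 2 \<and> R 3" for R :: "nat \<Rightarrow> bool"
    by (simp add: numeral_eq_Suc All_less_Suc) blast
  have neq: "B0 \<noteq> B1" "B0 \<noteq> B2" "B0 \<noteq> B3" "B1 \<noteq> B2" "B1 \<noteq> B3" "B2 \<noteq> B3"
    using meets dist by auto
  let ?B = "\<lambda>i. [B0, B1, B2, B3] ! i"
  \<comment> \<open>Only entries with \<open>i < j\<close> matter; the others are filled with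
    \<open>P01\<close>.\<close>
  let ?P = "\<lambda>i j. [[P01, P01, P02, P03], [P01, P01, P12, P13], [P01, P01, P01, P23]] ! i ! j"
  show ?thesis
    unfolding has_ONan_def all4
    by (rule exI[of _ ?B], rule exI[of _ ?P]) (use blocks meets dist neq neq[symmetric] in auto)
qed

section \<open>The planar functions\<close>

text \<open>Intended values are \<open>r = p ^ k\<close>, \<open>s = p ^ i\<close> and
  \<open>m = n div gcd k n\<close>; the case \<open>r = 1\<close> gives the first function.
  \<open>period\<close> says that the automorphism \<open>x ^ r\<close> has order dividing the odd
  number \<open>m\<close>.\<close>

locale twisted_square =
  fixes \<alpha> :: "'a::{field, finite}" and r s m :: nat
  assumes two: "(2::'a) \<noteq> 0"
    and minus_one: "\<exists>\<iota>::'a. \<iota> ^ 2 = -1"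
    and nonsquare: "\<And>y. y ^ 2 \<noteq> \<alpha>"
    and add_r: "\<And>x y :: 'a. (x + y) ^ r = x ^ r + y ^ r"
    and add_s: "\<And>x y :: 'a. (x + y) ^ s = x ^ s + y ^ s"
    and odd_r: "odd r" and odd_s: "odd s" and odd_m: "odd m"
    and period: "\<And>x :: 'a. x ^ (r ^ m) = x"
begin

definition g :: "'a ext \<Rightarrow> 'a ext" where
  "g x = (fst x ^ (r + 1) + \<alpha> * snd x ^ (s * (r + 1)), 2 * fst x * snd x)"

lemma minus_r: "(- x) ^ r = - (x ^ r)" for x :: 'a
  using odd_r by simp

lemma minus_s: "(- x) ^ s = - (x ^ s)" for x :: 'a
  using odd_s by simp

lemma diff_r: "(x - y) ^ r = x ^ r - y ^ r" for x y :: 'a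
  using add_r[of x "- y"] by (simp add: minus_r)

lemma diff_s: "(x - y) ^ s = x ^ s - y ^ s" for x y :: 'a
  using add_s[of x "- y"] by (simp add: minus_s)

lemma r_pos: "r > 0" and s_pos: "s > 0"
  using odd_r odd_s by (auto intro: Nat.gr0I)

lemma eq_minus_self: "v = - v \<Longrightarrow> v = 0" for v :: 'a
proof -
  assume "v = - v"
  then have "2 * v = 0"
    by (metis add.right_inverse mult_2)
  then show "v = 0"
    using two by simp
qed

text \<open>Applying \<open>v ^ r\<close> an odd number \<open>m\<close> of times returns
  \<open>v\<close> by \<open>period\<close>, but \<open>- v\<close> by the assumption.\<close>

lemma negated_by_r:
  fixes v :: 'a
  assumes "v ^ r = - v"
  shows "v = 0"
proof -
  have "v ^ (r ^ j) = (if even j then v else - v)" for j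
    by (induction j) (simp_all add: power_mult mult.commute[of r] assms minus_r)
  from this[of m] have "v = - v"
    using period odd_m by simp
  then show ?thesis
    by (rule eq_minus_self)
qed

text \<open>The same argument with inversion in place of negation: \<open>m\<close> iterations give
  \<open>v = inverse v\<close>.\<close>

lemma inverted_by_r:
  fixes v :: 'a
  assumes "v ^ (r + 1) = 1"
  shows "v = 1 \<or> v = -1"
proof -
  have "v \<noteq> 0"
    using assms by auto
  then have "v ^ r = inverse v"
    using assms by (simp add: field_simps)
  then have "v ^ (r ^ j) = (if even j then v else inverse v)" for j
    by (induction j) (simp_all add: power_mult mult.commute[of r] power_inverse)
  from this[of m] have "v = inverse v"
    using period odd_m by simp
  with \<open>v \<noteq> 0\<close> have "v ^ 2 = 1"
    by (metis power2_eq_square right_inverse)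
  then show ?thesis
    by (simp add: power2_eq_1_iff)
qed

lemma minus_nonsquare: "y ^ 2 \<noteq> - \<alpha>" for y :: 'a
proof
  assume *: "y ^ 2 = - \<alpha>"
  obtain \<iota> :: 'a where "\<iota> ^ 2 = -1"
    using minus_one by blast
  then have "(\<iota> * y) ^ 2 = \<alpha>"
    by (simp add: power_mult_distrib *)
  then show False
    using nonsquare by blast
qed

text \<open>Otherwise a square root of -1 would be negated by the automorphism. The residue makes
  \<open>(r + 1) div 2\<close> odd, as the point count requires.\<close>

lemma r_mod_4: "r mod 4 = 1"
proof (rule ccontr)
  assume "r mod 4 \<noteq> 1"
  then have "r mod 4 = 3"
    using odd_r by presburger
  then obtain k where k: "r = 4 * k + 3"
    by (metis mult_div_mod_eq)
  obtain \<iota> :: 'a where \<iota>: "\<iota> ^ 2 = -1"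
    using minus_one by blast
  have "\<iota> ^ 4 = (\<iota> ^ 2) ^ 2"
    by (simp flip: power_mult)
  then have "\<iota> ^ 4 = 1"
    by (simp add: \<iota>)
  then have "\<iota> ^ r = \<iota> ^ 2 * \<iota>"
    by (simp add: k power_add power_mult power3_eq_cube power2_eq_square)
  then have "\<iota> = 0"
    by (intro negated_by_r) (simp add: \<iota>)
  then show False
    using \<iota> by simp
qed

text \<open>The second equation forces \<open>y0 = v * d0\<close>, \<open>y1 = - (v * d1)\<close>
  when \<open>d0\<close> is nonzero. The first then compares \<open>d0 ^ (r + 1) * w\<close> with
  \<open>\<alpha>\<close> times the \<open>s\<close>-th power of \<open>d1 ^ (r + 1) * w\<close>,
  where \<open>w = v ^ r + v\<close>.\<close>

lemma kernel_trivial: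
  assumes fst_eq: "(y0 ^ r * d0 + y0 * d0 ^ r) + \<alpha> * (y1 ^ r * d1 + y1 * d1 ^ r) ^ s = 0"
    and snd_eq: "y0 * d1 + y1 * d0 = 0"
    and nz: "d0 \<noteq> 0 \<or> d1 \<noteq> 0"
  shows "y0 = 0 \<and> y1 = 0"
proof (cases "d0 = 0")
  case True
  then have "d1 \<noteq> 0" "y0 = 0"
    using nz snd_eq by auto
  have "\<alpha> \<noteq> 0"
    using nonsquare[of 0] by auto
  then have "y1 ^ r * d1 + y1 * d1 ^ r = 0"
    using fst_eq True \<open>y0 = 0\<close> r_pos by simp
  then have "y1 ^ r * d1 = - (y1 * d1 ^ r)"
    by (simp add: eq_neg_iff_add_eq_0)
  then have "(y1 / d1) ^ r = - (y1 / d1)"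
    using \<open>d1 \<noteq> 0\<close> by (simp add: power_divide field_simps)
  then have "y1 / d1 = 0"
    by (rule negated_by_r)
  then show ?thesis
    using \<open>d1 \<noteq> 0\<close> \<open>y0 = 0\<close> by simp
next
  case False
  define v where "v = y0 / d0"
  define w where "w = v ^ r + v"
  have y0: "y0 = v * d0"
    using False by (simp add: v_def)
  have "(y1 + v * d1) * d0 = 0"
    using snd_eq unfolding y0 by algebra
  then have y1: "y1 = - (v * d1)"
    using False by (simp add: eq_neg_iff_add_eq_0)
  have "w = 0"
  proof (rule ccontr)
    assume "w \<noteq> 0"
    \<comment> \<open>Since \<open>r + 1\<close> is even and \<open>s\<close> is odd, cancelling one
      factor \<open>w\<close> leaves squares on both sides apart from \<open>\<alpha>\<close>, which
      would thus be a square.\<close>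
    obtain e where e: "r + 1 = 2 * e"
      using odd_r by (metis evenE odd_even_add odd_one)
    obtain j where j: "s = 2 * j + 1"
      using odd_s by (elim oddE)
    have pow: "x ^ r * x = (x ^ e) ^ 2" for x :: 'a
      by (metis e mult.commute power_add power_mult power_one_right)
    have "y0 ^ r * d0 + y0 * d0 ^ r = (d0 ^ r * d0) * w"
      unfolding y0 w_def power_mult_distrib by algebra
    moreover have "y1 ^ r * d1 + y1 * d1 ^ r = - ((d1 ^ r * d1) * w)"
      unfolding y1 w_def minus_r power_mult_distrib by algebra
    ultimately have "(d0 ^ e) ^ 2 * w = \<alpha> * ((d1 ^ e) ^ 2 * w) ^ s"
      using fst_eq by (simp add: pow minus_s)
    also have "\<dots> = \<alpha> * ((d1 ^ e) ^ s * w ^ j) ^ 2 * w"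
      by (simp add: j power_mult_distrib power_add power_mult mult.commute mult.left_commute flip: power_mult)
    finally have sq: "(d0 ^ e) ^ 2 = \<alpha> * ((d1 ^ e) ^ s * w ^ j) ^ 2"
      using \<open>w \<noteq> 0\<close> by simp
    moreover have "(d0 ^ e) ^ 2 \<noteq> 0"
      using False by simp
    ultimately have "((d0 ^ e) / ((d1 ^ e) ^ s * w ^ j)) ^ 2 = \<alpha>"
      by (auto simp: power_divide)
    then show False
      using nonsquare by blast
  qed
  then have "v = 0"
    by (intro negated_by_r) (simp add: w_def eq_neg_iff_add_eq_0)
  then show ?thesis
    by (simp add: y0 y1)
qed

text \<open>Planarity as injectivity of a difference map: two lines with distinct directions share
  at most one affine point.\<close>

lemma planar:
  assumes eq: "esub (g (eadd x a)) (g (eadd x b)) = esub (g (eadd x' a)) (g (eadd x' b))" and "a \<noteq> b"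
  shows "x = x'"
proof -
  obtain x0 x1 x0' x1' a0 a1 b0 b1 where [simp]: "x = (x0, x1)" "x' = (x0', x1')" "a = (a0, a1)" "b = (b0, b1)"
    by (metis surj_pair)
  \<comment> \<open>the polar form is additive in \<open>u - u'\<close>, which reduces the claim to its kernel\<close>
  have polar: "(u + c) ^ (r + 1) - (u + d) ^ (r + 1) - ((u' + c) ^ (r + 1) - (u' + d) ^ (r + 1))
      = (u - u') ^ r * (c - d) + (u - u') * (c - d) ^ r" for u u' c d :: 'a
    unfolding power_add power_one_right add_r diff_r by algebra
  have "(x0 - x0') ^ r * (a0 - b0) + (x0 - x0') * (a0 - b0) ^ r
      + \<alpha> * ((x1 - x1') ^ r * (a1 - b1) + (x1 - x1') * (a1 - b1) ^ r) ^ s = 0"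
  proof -
    have "(x0 + a0) ^ (r + 1) + \<alpha> * ((x1 + a1) ^ (r + 1)) ^ s - ((x0 + b0) ^ (r + 1) + \<alpha> * ((x1 + b1) ^ (r + 1)) ^ s)
        = (x0' + a0) ^ (r + 1) + \<alpha> * ((x1' + a1) ^ (r + 1)) ^ s - ((x0' + b0) ^ (r + 1) + \<alpha> * ((x1' + b1) ^ (r + 1)) ^ s)"
      using eq unfolding power_mult[symmetric] mult.commute[of _ s]
      by (simp add: g_def esub_def eadd_def)
    then show ?thesis
      unfolding polar[symmetric] diff_s by (simp add: algebra_simps del: power_Suc)
  qed
  moreover have "(x0 - x0') * (a1 - b1) + (x1 - x1') * (a0 - b0) = 0"
  proof -
    have "2 * ((x0 + a0) * (x1 + a1)) - 2 * ((x0 + b0) * (x1 + b1))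
        = 2 * ((x0' + a0) * (x1' + a1)) - 2 * ((x0' + b0) * (x1' + b1))"
      using eq by (simp add: g_def esub_def eadd_def mult.assoc[symmetric])
    then have "2 * ((x0 - x0') * (a1 - b1) + (x1 - x1') * (a0 - b0)) = 0"
      by algebra
    then show ?thesis
      using two by (metis mult_eq_0_iff)
  qed
  moreover have "a0 - b0 \<noteq> 0 \<or> a1 - b1 \<noteq> 0"
    using \<open>a \<noteq> b\<close> by auto
  ultimately have "x0 - x0' = 0 \<and> x1 - x1' = 0"
    by (rule kernel_trivial)
  then show ?thesis by simp
qed

lemma card_fst_g:
  assumes "c \<noteq> 0"
  shows "card {x. fst (g x) = c} = CARD('a) + 1"
proof -
  \<comment> \<open>The \<open>e\<close>-th power is injective: by \<open>inverted_by_r\<close> its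
    kernel lies in 1 and -1, and odd \<open>e\<close> excludes -1. Hence \<open>?\<phi>\<close> maps
    the curve bijectively to a conic.\<close>
  define e where "e = (r + 1) div 2"
  have e: "r + 1 = e * 2" and "odd e"
    using r_mod_4 unfolding e_def by presburger+
  have inj_e: "x = y" if "x ^ e = y ^ e" for x y :: 'a
  proof (cases "y = 0")
    case False
    then have one: "(x / y) ^ e = 1"
      using that by (simp add: power_divide)
    then have "(x / y) ^ (r + 1) = 1"
      by (simp only: e power_mult power_one)
    then have "x / y = 1 \<or> x / y = -1"
      by (rule inverted_by_r)
    moreover have "x / y \<noteq> -1"
    proof
      assume "x / y = -1"
      then have "1 = - (1 :: 'a)"
        using one \<open>odd e\<close> by simp
      then show False
        using eq_minus_self[of 1] by simp
    qed
    ultimately show ?thesis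
      using False by simp
  next
    case True
    then show ?thesis
      using that \<open>odd e\<close> by (cases e) auto
  qed
  have inj_s: "x = y" if "x ^ s = y ^ s" for x y :: 'a
    using that diff_s[of x y] s_pos by simp
  let ?\<phi> = "\<lambda>x :: 'a \<times> 'a. (fst x ^ e, (snd x ^ s) ^ e)"
  have "inj ?\<phi>"
    by (intro injI) (auto simp: prod_eq_iff dest!: inj_e inj_s)
  then have "bij ?\<phi>"
    by (simp add: bij_def finite_UNIV_inj_surj)
  have "{x. fst (g x) = c} = ?\<phi> -` {(u, v). u ^ 2 + \<alpha> * v ^ 2 = c}"
    unfolding g_def e power_mult by auto
  moreover have "card (?\<phi> -` {(u, v). u ^ 2 + \<alpha> * v ^ 2 = c}) = card {(u, v). u ^ 2 + \<alpha> * v ^ 2 = c}"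
    by (rule card_vimage_inj) (use \<open>bij ?\<phi>\<close> in \<open>simp_all add: bij_def\<close>)
  ultimately have "card {x. fst (g x) = c} = card {(u, v). u ^ 2 + \<alpha> * v ^ 2 = c}"
    by simp
  then show ?thesis
    using card_anisotropic_conic[OF minus_nonsquare assms] by simp
qed

section \<open>Blocks of the unital\<close>

text \<open>The direction \<open>Dir a\<close> is outside the unital, and an affine point is inside
  when the first component of its second coordinate vanishes.\<close>

lemma mem_Lab_block:
  "Q \<in> points_of g (Lab a b) \<inter> U_xi \<longleftrightarrow> (\<exists>x. fst (g (eadd x a)) = fst b \<and> Q = Aff x (esub (g (eadd x a)) b))"
  by (cases Q) (auto simp: points_of_def U_xi_def esub_def)

lemma mem_Na_block:
  "Q \<in> points_of g (Na a) \<inter> U_xi \<longleftrightarrow> Q = DirInf \<or> (\<exists>t. Q = Aff a (0, t))"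
  by (cases Q) (auto simp: points_of_def U_xi_def)

lemma Lab_block:
  assumes "fst b \<noteq> 0"
  shows "points_of g (Lab a b) \<inter> U_xi \<in> blocks g (CARD('a)) U_xi"
proof -
  let ?P = "\<lambda>y. Aff (esub y a) (esub (g y) b)"
  have *: "eadd (esub y a) a = y" "esub (eadd y a) a = y" for y :: "'a ext"
    by (simp_all add: eadd_def esub_def)
  have "points_of g (Lab a b) \<inter> U_xi = ?P ` {y. fst (g y) = fst b}"
  proof (intro equalityI subsetI)
    fix Q assume "Q \<in> points_of g (Lab a b) \<inter> U_xi"
    then obtain x where "fst (g (eadd x a)) = fst b" "Q = Aff x (esub (g (eadd x a)) b)"
      unfolding mem_Lab_block by blast
    then show "Q \<in> ?P ` {y. fst (g y) = fst b}"
      by (intro image_eqI[of _ _ "eadd x a"]) (simp_all add: *)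
  next
    fix Q assume "Q \<in> ?P ` {y. fst (g y) = fst b}"
    then obtain y where "fst (g y) = fst b" "Q = ?P y" by auto
    then show "Q \<in> points_of g (Lab a b) \<inter> U_xi"
      unfolding mem_Lab_block by (intro exI[of _ "esub y a"]) (simp add: *)
  qed
  moreover have "inj ?P"
    by (intro injI) (auto simp: esub_def prod_eq_iff)
  ultimately have "card (points_of g (Lab a b) \<inter> U_xi) = CARD('a) + 1"
    using card_fst_g[OF assms] by (simp add: card_image inj_on_subset)
  then show ?thesis
    by (auto simp: blocks_def)
qed

lemma Na_block: "points_of g (Na a) \<inter> U_xi \<in> blocks g (CARD('a)) U_xi"
proof -
  have "points_of g (Na a) \<inter> U_xi = insert DirInf (range (\<lambda>t. Aff a (0, t)))"
    by (intro set_eqI, unfold mem_Na_block) auto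
  moreover have "card (range (\<lambda>t::'a. Aff a (0::'a, t))) = CARD('a)"
    by (intro card_image injI) simp
  ultimately have "card (points_of g (Na a) \<inter> U_xi) = CARD('a) + 1"
    by (simp add: card_insert_if image_iff)
  then show ?thesis
    by (auto simp: blocks_def)
qed

text \<open>Every common point lies over an \<open>x\<close> where the difference of the two
  translates of \<open>g\<close> equals \<open>esub b b'\<close>; \<open>planar\<close> leaves one
  such \<open>x\<close>.\<close>

lemma Lab_Lab_meet:
  assumes "a \<noteq> a'" "Q \<in> points_of g (Lab a b) \<inter> U_xi" "Q \<in> points_of g (Lab a' b') \<inter> U_xi"
  shows "(points_of g (Lab a b) \<inter> U_xi) \<inter> (points_of g (Lab a' b') \<inter> U_xi) = {Q}"
proof -
  have "R = Q" if R: "R \<in> points_of g (Lab a b) \<inter> U_xi" "R \<in> points_of g (Lab a' b') \<inter> U_xi" for R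
  proof -
    obtain x where x: "Q = Aff x (esub (g (eadd x a)) b)" "esub (g (eadd x a)) b = esub (g (eadd x a')) b'"
      using assms(2,3) unfolding mem_Lab_block by (metis ppoint.inject(1))
    obtain x' where x': "R = Aff x' (esub (g (eadd x' a)) b)" "esub (g (eadd x' a)) b = esub (g (eadd x' a')) b'"
      using R unfolding mem_Lab_block by (metis ppoint.inject(1))
    have "esub (g (eadd x a)) (g (eadd x a')) = esub b b'"
         "esub (g (eadd x' a)) (g (eadd x' a')) = esub b b'"
      using x(2) x'(2) by (auto simp: esub_def algebra_simps)
    then have "x = x'"
      using planar[of x a a' x'] assms(1) by simp
    then show "R = Q"
      using x x' by simp
  qed
  then show ?thesis
    using assms by blast
qed

lemma Na_Lab_meet:
  assumes "Q \<in> points_of g (Na a) \<inter> U_xi" "Q \<in> points_of g (Lab a' b') \<inter> U_xi"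
  shows "(points_of g (Na a) \<inter> U_xi) \<inter> (points_of g (Lab a' b') \<inter> U_xi) = {Q}"
proof -
  have "R = Aff a (esub (g (eadd a a')) b')"
    if "R \<in> points_of g (Na a) \<inter> U_xi" "R \<in> points_of g (Lab a' b') \<inter> U_xi" for R
    using that unfolding mem_Lab_block mem_Na_block by auto
  then show ?thesis
    using assms by blast
qed

section \<open>The O'Nan configuration\<close>

lemma has_ONan_g: "has_ONan g (CARD('a)) U_xi"
proof -
  have "inj (\<lambda>v :: 'a. v ^ r + v)"
  proof (rule injI)
    fix x y :: 'a
    assume "x ^ r + x = y ^ r + y"
    then have "x ^ r = y ^ r + y - x"
      by (simp add: eq_diff_eq)
    then have "x - y = 0"
      by (intro negated_by_r) (simp add: diff_r)
    then show "x = y"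
      by simp
  qed
  then have "surj (\<lambda>v :: 'a. v ^ r + v)"
    by (simp add: finite_UNIV_inj_surj)
  from surjD[OF this, of "\<alpha> + 1"] obtain h where h_sum: "h ^ r + h = \<alpha> + 1"
    by auto
  then have h_r: "h ^ r = \<alpha> + 1 - h"
    by (simp add: eq_diff_eq)
  have "\<alpha> + 1 \<noteq> 0"
  proof
    assume "\<alpha> + 1 = 0"
    then have "\<alpha> = -1"
      by (simp add: eq_neg_iff_add_eq_0)
    then show False
      using minus_one nonsquare by blast
  qed
  then have "h \<noteq> 0"
    using h_sum \<open>\<alpha> + 1 \<noteq> 0\<close> by (metis add_0_right r_pos zero_power)
  have "h \<noteq> 1"
    using h_r nonsquare[of 1] by auto
  \<comment> \<open>With \<open>h\<close> equal to one half, \<open>h\<close> is fixed by the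
    automorphism because 2 is, so \<open>h ^ r + h = 1\<close> and
    \<open>\<alpha> = 0\<close>.\<close>
  have "2 * h \<noteq> 1"
  proof
    assume half: "2 * h = 1"
    have "2 ^ r = (2 :: 'a)"
      using add_r[of 1 1] by simp
    then have "2 * h ^ r = 1"
      using half power_mult_distrib[of 2 h r] by simp
    then have "2 * (h ^ r + h) = 2"
      using half by (simp add: distrib_left)
    then have "\<alpha> = 0"
      using two h_sum by simp
    then show False
      using nonsquare[of 0] by simp
  qed
  define c1 c2 c3 :: "'a ext" where "c1 = (h - 1, -1)" and "c2 = (- h, 0)" and "c3 = (- h, -1)"
  define \<rho> where "\<rho> = h ^ r * h"
  \<comment> \<open>The first components make the three curves pass through the origin. The second
    components make the lines meet over \<open>(1, 1)\<close>, \<open>(0, 2)\<close> and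
    \<open>(2 * h, 0)\<close>, with \<open>snd b3 = 0\<close> as normalisation.\<close>
  define b1 b2 b3 :: "'a ext" where "b1 = (\<rho>, 4 * h - 2)" and "b2 = (\<rho>, 2 * h)" and "b3 = (\<rho> + \<alpha>, 0)"
  have "\<rho> \<noteq> 0"
    using \<open>h \<noteq> 0\<close> by (simp add: \<rho>_def)
  \<comment> \<open>Needed for \<open>Lab_block\<close>: \<open>\<rho>\<close> is a square since
    \<open>r + 1\<close> is even, while \<open>- \<alpha>\<close> is not.\<close>
  have "\<rho> + \<alpha> \<noteq> 0"
  proof
    assume "\<rho> + \<alpha> = 0"
    obtain e where "r + 1 = e * 2"
      using odd_r by (metis evenE odd_even_add odd_one mult.commute)
    then have "\<rho> = (h ^ e) ^ 2"
      unfolding \<rho>_def by (metis power_add power_mult power_one_right)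
    then show False
      using \<open>\<rho> + \<alpha> = 0\<close> minus_nonsquare by (simp add: eq_neg_iff_add_eq_0)
  qed
  have g_0: "g (u, 0) = (u ^ r * u, 0)" for u
    using s_pos by (simp add: g_def mult.commute)
  have g_1: "g (u, 1) = (u ^ r * u + \<alpha>, 2 * u)" for u
    by (simp add: g_def mult.commute)
  have g_minus_1: "g (u, -1) = (u ^ r * u + \<alpha>, - (2 * u))" for u
  proof -
    have "even (s * (r + 1))"
      using odd_r by simp
    then have "(-1 :: 'a) ^ (s * (r + 1)) = 1"
      by (rule neg_one_even_power)
    then show ?thesis
      unfolding g_def by (simp add: mult.commute)
  qed
  \<comment> \<open>this is where the choice of \<open>h\<close> enters: \<open>(h - 1)^(r+1) + \<alpha> = h^(r+1)\<close>\<close>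
  have rotated: "(h - 1) ^ r * (h - 1) + \<alpha> = \<rho>" "(1 - h) ^ r * (1 - h) + \<alpha> = \<rho>"
    unfolding \<rho>_def diff_r h_r power_one by algebra+
  have sums: "eadd (0, 0) c1 = (h - 1, -1)" "eadd (0, 0) c2 = (- h, 0)" "eadd (0, 0) c3 = (- h, -1)"
    "eadd (1, 1) c1 = (h, 0)" "eadd (1, 1) c2 = (1 - h, 1)" "eadd (0, 2) c1 = (h - 1, 1)"
    "eadd (0, 2) c3 = (- h, 1)" "eadd (2 * h, 0) c2 = (h, 0)" "eadd (2 * h, 0) c3 = (h, -1)"
    by (simp_all add: eadd_def c1_def c2_def c3_def)
  have g_values: "g (h, 0) = (\<rho>, 0)" "g (- h, 0) = (\<rho>, 0)"
    "g (h - 1, 1) = (\<rho>, 2 * (h - 1))" "g (h - 1, -1) = (\<rho>, - (2 * (h - 1)))" "g (1 - h, 1) = (\<rho>, 2 * (1 - h))"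
    "g (h, -1) = (\<rho> + \<alpha>, - (2 * h))" "g (- h, 1) = (\<rho> + \<alpha>, - (2 * h))" "g (- h, -1) = (\<rho> + \<alpha>, 2 * h)"
    unfolding g_0 g_1 g_minus_1 rotated by (simp_all add: minus_r \<rho>_def)
  note calc = sums g_values b1_def b2_def b3_def esub_def
  define L1 L2 L3 where "L1 = points_of g (Lab c1 b1) \<inter> U_xi"
    and "L2 = points_of g (Lab c2 b2) \<inter> U_xi" and "L3 = points_of g (Lab c3 b3) \<inter> U_xi"
  define N where "N = points_of g (Na (0, 0)) \<inter> U_xi"
  note block_defs = L1_def L2_def L3_def N_def
  have in_block: "Q \<in> points_of g (Lab a b) \<inter> U_xi"
    if "fst (g (eadd x a)) = fst b" "Q = Aff x (esub (g (eadd x a)) b)" for Q x a b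
    unfolding mem_Lab_block using that by blast
  have c_distinct: "c1 \<noteq> c2" "c1 \<noteq> c3" "c2 \<noteq> c3"
    using \<open>2 * h \<noteq> 1\<close> by (auto simp: c1_def c2_def c3_def algebra_simps eq_neg_iff_add_eq_0)
  have L12: "L1 \<inter> L2 = {Aff (1, 1) (0, 2 - 4 * h)}"
    unfolding block_defs
    by (rule Lab_Lab_meet[OF c_distinct(1)]; rule in_block[where x = "(1, 1)"]) (simp_all add: calc algebra_simps)
  have L13: "L1 \<inter> L3 = {Aff (0, 2) (0, - 2 * h)}"
    unfolding block_defs
    by (rule Lab_Lab_meet[OF c_distinct(2)]; rule in_block[where x = "(0, 2)"]) (simp_all add: calc algebra_simps)
  have L23: "L2 \<inter> L3 = {Aff (2 * h, 0) (0, - 2 * h)}"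
    unfolding block_defs
    by (rule Lab_Lab_meet[OF c_distinct(3)]; rule in_block[where x = "(2 * h, 0)"]) (simp_all add: calc)
  have in_N: "Aff (0, 0) (0, t) \<in> points_of g (Na (0, 0)) \<inter> U_xi" for t
    unfolding mem_Na_block by blast
  have N1: "N \<inter> L1 = {Aff (0, 0) (0, 4 - 6 * h)}"
    unfolding block_defs
    by (rule Na_Lab_meet[OF in_N]; rule in_block[where x = "(0, 0)"]) (simp_all add: calc algebra_simps)
  have N2: "N \<inter> L2 = {Aff (0, 0) (0, - 2 * h)}"
    unfolding block_defs
    by (rule Na_Lab_meet[OF in_N]; rule in_block[where x = "(0, 0)"]) (simp_all add: calc algebra_simps)
  have N3: "N \<inter> L3 = {Aff (0, 0) (0, 2 * h)}"
    unfolding block_defs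
    by (rule Na_Lab_meet[OF in_N]; rule in_block[where x = "(0, 0)"]) (simp_all add: calc algebra_simps)
  \<comment> \<open>The three points on \<open>N\<close> differ only in this coordinate; the other
    three lie over distinct nonzero \<open>x\<close>.\<close>
  have "4 - 6 * h \<noteq> - 2 * h"
  proof
    assume "4 - 6 * h = - 2 * h"
    then have "2 * (2 * (1 - h)) = 0" by algebra
    then show False using two \<open>h \<noteq> 1\<close> by (metis eq_iff_diff_eq_0 mult_eq_0_iff)
  qed
  moreover have "4 - 6 * h \<noteq> 2 * h"
  proof
    assume "4 - 6 * h = 2 * h"
    then have "2 * (2 * (1 - 2 * h)) = 0" by algebra
    then show False using two \<open>2 * h \<noteq> 1\<close> by (metis eq_iff_diff_eq_0 mult_eq_0_iff)
  qed
  moreover have "- 2 * h \<noteq> 2 * h"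
    using eq_minus_self[of "2 * h"] two \<open>h \<noteq> 0\<close> by (metis mult_eq_0_iff mult_minus_left)
  ultimately show ?thesis
    using \<open>h \<noteq> 0\<close> two \<open>\<rho> \<noteq> 0\<close> \<open>\<rho> + \<alpha> \<noteq> 0\<close>
    by (intro has_ONanI[OF _ _ _ _ N1 N2 N3 L12 L13 L23])
      (auto simp: block_defs b1_def b2_def b3_def intro!: Na_block Lab_block)
qed

end

theorem theorem3p15:
  fixes p n q :: nat and \<alpha> :: "'a::{field, finite}" and f :: "'a ext \<Rightarrow> 'a ext"
  assumes "prime p" and "odd p" and "n > 0" and "q = p ^ n"
    and "card (UNIV :: 'a set) = q" and "q mod 4 = 1"
    and "\<not> (\<exists>y::'a. y ^ 2 = \<alpha>)"
    and "(\<exists>i. 0 < i \<and> i < n \<and> f = f_one \<alpha> p i) \<or>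
         (\<exists>i k. 0 < i \<and> i < n \<and> 0 < k \<and> k < n \<and> odd (n div gcd k n) \<and> f = f_two \<alpha> p k i)"
    and "\<exists>\<omega>::'a. \<omega> ^ 2 - \<omega> + 1 = 0"
  shows "has_ONan f q U_xi"
proof -
  obtain i k where odd_quot: "odd (n div gcd k n)"
    and f: "f = (\<lambda>x. (fst x ^ (p ^ k + 1) + \<alpha> * snd x ^ (p ^ i * (p ^ k + 1)), 2 * fst x * snd x))"
  proof -
    from assms(8) consider i where "f = f_one \<alpha> p i"
      | i k where "odd (n div gcd k n)" "f = f_two \<alpha> p k i"
      by blast
    then show ?thesis
    proof cases
      case 1
      \<comment> \<open>The first function is the case \<open>k = 0\<close>, where
        \<open>n div gcd 0 n = 1\<close> is odd.\<close>
      have "p ^ 0 + 1 = 2" "p ^ i * 2 = 2 * p ^ i"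
        by simp_all
      then have "f x = (fst x ^ (p ^ 0 + 1) + \<alpha> * snd x ^ (p ^ i * (p ^ 0 + 1)), 2 * fst x * snd x)" for x
        by (simp only: 1 f_one_def)
      then show ?thesis
        by (intro that[of 0 i]) (use \<open>n > 0\<close> in auto)
    next
      case 2
      have "p ^ (k + i) + p ^ i = p ^ i * (p ^ k + 1)"
        by (simp add: power_add algebra_simps)
      then have "f x = (fst x ^ (p ^ k + 1) + \<alpha> * snd x ^ (p ^ i * (p ^ k + 1)), 2 * fst x * snd x)" for x
        by (simp only: 2 f_two_def)
      then show ?thesis
        by (intro that[of k i] 2(1)) blast
    qed
  qed
  have char: "CHAR('a) = p"
    using finite_field_CHAR assms by blast
  interpret twisted_square \<alpha> "p ^ k" "p ^ i" "n div gcd k n"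
  proof
    show "(2 :: 'a) \<noteq> 0"
    proof
      assume "(2 :: 'a) = 0"
      then have "p dvd 2"
        using of_nat_eq_0_iff_char_dvd[where 'a = 'a, of 2] char by simp
      then show False
        using assms(1,2) primes_dvd_imp_eq[of p 2] by auto
    qed
    show "\<exists>\<iota>::'a. \<iota> ^ 2 = -1"
      using finite_field_sqrt_minus_1[where 'a = 'a] assms(5,6) by simp
    show "y ^ 2 \<noteq> \<alpha>" for y
      using assms(7) by blast
    show "(x + y) ^ p ^ k = x ^ p ^ k + y ^ p ^ k" "(x + y) ^ p ^ i = x ^ p ^ i + y ^ p ^ i" for x y :: 'a
      using freshmans_dream'[where 'a = 'a] char assms(1) by blast+
    show "odd (p ^ k)" "odd (p ^ i)"
      using assms(2) by simp_all
    show "odd (n div gcd k n)"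
      by (rule odd_quot)
    \<comment> \<open>This turns the \<open>m\<close>-fold iterate of the \<open>p ^ k\<close>-th
      power into an iterate of the \<open>q\<close>-th power, which is the identity.\<close>
    have "k * (n div gcd k n) = n * (k div gcd k n)"
      by (metis dvd_div_mult gcd_dvd1 gcd_dvd2 mult.commute)
    then have "(p ^ k) ^ (n div gcd k n) = q ^ (k div gcd k n)"
      by (simp add: assms(4) flip: power_mult)
    then show "x ^ (p ^ k) ^ (n div gcd k n) = x" for x :: 'a
      using finite_field_power_card_power[of x] assms(5) by simp
  qed
  have "f = g"
    by (simp add: f g_def fun_eq_iff)
  then show ?thesis
    using has_ONan_g assms(5) by simp
qed

end
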